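(* Let $k > 0$ and, for each $n \in \mathbb{N}$, let $X_n$ be a random variable taking values in $\{0,\ldots,n\}$ with standard deviation $\sigma_n$. Let $\Lambda_n$ be the multiset of complex roots (counted with multiplicity) of the probability generating function $P_n$ of $X_n$. If $\sigma_n \to \infty$ and \[ \sum_{\zeta \in \Lambda_n} |\zeta|^{-k} \to 0 \] as $n \to \infty$, then $\{X_n\}$ satisfies a central limit theorem.
   Context: The probability generating function of a random variable $X_n \in \{0,\ldots,n\}$ is the polynomial $P_n(z) = \sum_{j=0}^n \mathbb{P}(X_n = j) z^j$. The convention $0^{-k} = +\infty$ is used, so the hypothesis on the sum includes that $P_n(0) \neq 0$ for all sufficiently large $n$. A sequence $\{X_n\}$ with means $\mu_n$ and standard deviations $\sigma_n$ (positive for all large $n$) satisfies a central limit theorem if $X_n^* = (X_n - \mu_n)\sigma_n^{-1}$ converges in distribution to $Z \sim \mathcal{N}(0,1)$ as $n \to \infty$. *)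

theory Defs
  imports "HOL-Probability.Probability"
    "HOL-Computational_Algebra.Computational_Algebra"
begin

definition prob_gen_poly :: "'a measure \<Rightarrow> nat \<Rightarrow> ('a \<Rightarrow> nat) \<Rightarrow> complex poly" where
  "prob_gen_poly M n X =
     (\<Sum>j\<le>n. monom (complex_of_real (measure M {\<omega> \<in> space M. X \<omega> = j})) j)"

definition mean :: "'a measure \<Rightarrow> ('a \<Rightarrow> nat) \<Rightarrow> real" where
  "mean M X = prob_space.expectation M (\<lambda>\<omega>. real (X \<omega>))"

definition std_dev :: "'a measure \<Rightarrow> ('a \<Rightarrow> nat) \<Rightarrow> real" where
  "std_dev M X = sqrt (prob_space.variance M (\<lambda>\<omega>. real (X \<omega>)))"

text \<open>The value at \<open>0\<close> is \<open>\<infinity>\<close>, whereas \<open>0 powr (- k)\<close> would be \<open>0\<close>.\<close>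

definition norm_neg_powr :: "real \<Rightarrow> complex \<Rightarrow> ennreal" where
  "norm_neg_powr k z = (if z = 0 then \<infinity> else ennreal (norm z powr (- k)))"

definition satisfies_clt :: "(nat \<Rightarrow> 'a measure) \<Rightarrow> (nat \<Rightarrow> 'a \<Rightarrow> nat) \<Rightarrow> bool" where
  "satisfies_clt M X \<longleftrightarrow>
     (\<forall>\<^sub>F n in sequentially. 0 < std_dev (M n) (X n)) \<and>
     weak_conv_m
       (\<lambda>n. distr (M n) borel
          (\<lambda>\<omega>. (real (X n \<omega>) - mean (M n) (X n)) / std_dev (M n) (X n)))
       std_normal_distribution"

end

theory Submission
  imports Defs "HOL-Complex_Analysis.Complex_Analysis"
begin

text \<open>
  Write \<open>z = e\<^sup>w\<close>. If \<open>P\<close> is the probability generating function of \<open>X\<close> and all its roots are far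
  from the unit disc, then \<open>E e\<^bsup>wX\<^esup> = P(e\<^sup>w)\<close> has a holomorphic logarithm \<open>G\<close> for \<open>|w| < 1\<close>, with
  \<open>G'(0) = \<mu>\<close> and \<open>G''(0) = \<sigma>\<^sup>2\<close>. The characteristic function of \<open>(X - \<mu>) / \<sigma>\<close> at \<open>t\<close> is
  \<open>exp (G(it/\<sigma>) - it\<mu>/\<sigma>)\<close>, and by Taylor's theorem its exponent differs from \<open>-t\<^sup>2/2\<close> by
  \<open>O(sup |G| \<cdot> |t|\<^sup>3 / \<sigma>\<^sup>3)\<close>. So everything rests on a bound \<open>|G| \<le> C (1 + \<sigma>\<^sup>2)\<close> with a constant \<open>C\<close>
  that does not depend on \<open>X\<close>: the error is then \<open>O(|t|\<^sup>3 / \<sigma>)\<close>, and Levy's continuity theorem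
  finishes the proof.

  The bound (\<open>log_mgf_bounded_by_variance\<close>) is obtained as follows. Fix an integer \<open>K \<ge> k\<close>.
  Expanding \<open>ln (1 - z/\<zeta>)\<close> up to order \<open>K\<close> and summing over the roots shows that \<open>log P\<close> is a
  polynomial \<open>q\<close> of degree less than \<open>K\<close>, up to a constant and a bounded error: the error is at
  most a multiple of \<open>\<Sum> |\<zeta>|\<^bsup>-K\<^esup>\<close>. It remains to control the coefficients of \<open>q\<close> by \<open>\<sigma>\<^sup>2\<close>. Since
  \<open>P\<close> has nonnegative coefficients, \<open>|P(z)| \<le> P(|z|)\<close>, that is,
  \<open>Re G(w) \<le> Re G(Re w)\<close>. This inequality is rigid (\<open>holomorphic_affine_of_Re_le\<close>): a holomorphic
  function that satisfies it and has vanishing second derivative at \<open>0\<close> is affine, because a zero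
  of order \<open>n \<ge> 3\<close> of the rest would make its real part too large in some nonreal direction. But \<open>q(e\<^sup>w) - q(0)\<close> is affine in \<open>w\<close> only if it is \<open>0\<close>. As the possible \<open>q\<close>, normalised,
  form a compact set, the second derivative \<open>\<Sum> j\<^sup>2 a\<^sub>j\<close> of \<open>q(e\<^sup>w)\<close> at \<open>0\<close> is at least a fixed multiple
  of \<open>\<Sum> |a\<^sub>j|\<close>, even when the inequality holds only approximately (\<open>exp_sum_coeffs_bound\<close>). This
  second derivative is \<open>\<sigma>\<^sup>2\<close> up to a bounded error.
\<close>

section \<open>The logarithm of a polynomial with large roots\<close>

lemma norm_ln_one_minus_remainder_le:
  fixes u :: complex
  assumes u: "norm u \<le> 1 / 2" and K: "1 \<le> K"
  shows "norm (ln (1 - u) + (\<Sum>j=1..<K. u ^ j / of_nat j)) \<le> 2 * norm u ^ K"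
proof -
  let ?f = "\<lambda>n. - (u ^ n) / of_nat n"
  have "?f sums ln (1 - u)"
    using Ln_series'[of "- u"] u by simp
  then have tail: "(\<lambda>i. ?f (i + K)) sums (ln (1 - u) - (\<Sum>i<K. ?f i))"
    by (rule sums_split_initial_segment)
  have "(\<Sum>i<K. ?f i) = (\<Sum>i=1..<K. ?f i)"
    by (rule sum.mono_neutral_right) (auto simp: not_le)
  then have head: "(\<Sum>i<K. ?f i) = - (\<Sum>j=1..<K. u ^ j / of_nat j)"
    by (simp add: sum_negf)
  have geo: "(\<lambda>i. norm u ^ K * (1 / 2) ^ i) sums (norm u ^ K * 2)"
    using geometric_sums[of "1 / 2 :: real"] by (intro sums_mult) simp
  have "norm (?f (i + K)) \<le> norm u ^ K * (1 / 2) ^ i" for i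
  proof -
    have "norm (?f (i + K)) = norm u ^ K * (norm u ^ i / real (i + K))"
      by (simp add: norm_divide norm_power norm_mult power_add del: of_nat_add)
    also have "norm u ^ i / real (i + K) \<le> norm u ^ i / 1"
      using K by (intro divide_left_mono) auto
    also have "norm u ^ i / 1 \<le> (1 / 2) ^ i"
      using power_mono[OF u] by simp
    finally show ?thesis
      by (simp add: mult_left_mono)
  qed
  from norm_sums_le[OF tail geo this] show ?thesis
    by (simp only: head diff_minus_eq_add mult.commute)
qed

text \<open>
  The \<open>a j\<close> are minus the power sums of the \<open>1 / \<zeta>\<close> divided by \<open>j\<close>. They can be arbitrarily large,
  since nothing bounds the number of elements of \<open>Z\<close>; only the terms of order \<open>K\<close> and higher,
  collected in \<open>\<rho>\<close>, are controlled by the sum of the \<open>|\<zeta>|\<^bsup>-K\<^esup>\<close>.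
\<close>

lemma prod_one_minus_eq_exp:
  fixes Z :: "complex multiset" and R :: real
  assumes R: "0 < R" and K: "1 \<le> K" and Z: "\<And>\<zeta>. \<zeta> \<in># Z \<Longrightarrow> 2 * R \<le> norm \<zeta>"
  obtains a :: "nat \<Rightarrow> complex" and \<rho>
  where "\<rho> holomorphic_on ball 0 R"
    and "\<And>z. z \<in> ball 0 R \<Longrightarrow> norm (\<rho> z) \<le> 2 * R ^ K * (\<Sum>\<zeta>\<in>#Z. 1 / norm \<zeta> ^ K)"
    and "\<And>z. z \<in> ball 0 R \<Longrightarrow>
           (\<Prod>\<zeta>\<in>#Z. 1 - z / \<zeta>) = exp ((\<Sum>j=1..<K. a j * z ^ j) + \<rho> z)"
proof -
  have "\<exists>a \<rho>. \<rho> holomorphic_on ball 0 R \<and>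
    (\<forall>z\<in>ball 0 R. norm (\<rho> z) \<le> 2 * R ^ K * (\<Sum>\<zeta>\<in>#Z. 1 / norm \<zeta> ^ K) \<and>
      (\<Prod>\<zeta>\<in>#Z. 1 - z / \<zeta>) = exp ((\<Sum>j=1..<K. a j * z ^ j) + \<rho> z))"
    using Z
  proof (induction Z)
    case empty
    have "(\<lambda>_. 0) holomorphic_on ball (0::complex) R"
      by simp
    then show ?case
      by (intro exI[of _ "\<lambda>_. 0"]) simp
  next
    case (add \<zeta> Z)
    have "\<And>\<zeta>'. \<zeta>' \<in># Z \<Longrightarrow> 2 * R \<le> norm \<zeta>'"
      using add.prems by simp
    from add.IH[OF this] obtain a \<rho> where hol: "\<rho> holomorphic_on ball 0 R"
      and bd: "\<And>z. z \<in> ball 0 R \<Longrightarrow> norm (\<rho> z) \<le> 2 * R ^ K * (\<Sum>\<zeta>\<in>#Z. 1 / norm \<zeta> ^ K)"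
      and eq: "\<And>z. z \<in> ball 0 R \<Longrightarrow>
        (\<Prod>\<zeta>\<in>#Z. 1 - z / \<zeta>) = exp ((\<Sum>j=1..<K. a j * z ^ j) + \<rho> z)"
      by blast
    have \<zeta>: "2 * R \<le> norm \<zeta>" "\<zeta> \<noteq> 0"
      using add.prems[of \<zeta>] R by auto
    define \<tau> where "\<tau> z = ln (1 - z / \<zeta>) + (\<Sum>j=1..<K. (z / \<zeta>) ^ j / of_nat j)" for z
    define b where "b j = a j - 1 / (\<zeta> ^ j * of_nat j)" for j
    have small: "norm (z / \<zeta>) \<le> 1 / 2" if "z \<in> ball 0 R" for z
      using that \<zeta> R by (simp add: norm_divide divide_simps)
    have slit: "1 - z / \<zeta> \<notin> \<real>\<^sub>\<le>\<^sub>0" if "z \<in> ball 0 R" for z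
    proof -
      have "Re (z / \<zeta>) \<le> 1 / 2"
        using small[OF that] complex_Re_le_cmod[of "z / \<zeta>"] by linarith
      then show ?thesis
        by (auto simp: complex_nonpos_Reals_iff)
    qed
    have "\<tau> holomorphic_on ball 0 R"
      unfolding \<tau>_def using \<zeta> slit by (auto intro!: holomorphic_intros)
    then have "(\<lambda>z. \<rho> z + \<tau> z) holomorphic_on ball 0 R"
      using hol by (intro holomorphic_intros)
    moreover have "norm (\<rho> z + \<tau> z) \<le> 2 * R ^ K * (\<Sum>\<zeta>\<in>#add_mset \<zeta> Z. 1 / norm \<zeta> ^ K)"
      if z: "z \<in> ball 0 R" for z
    proof -
      have "norm (\<tau> z) \<le> 2 * norm (z / \<zeta>) ^ K"
        unfolding \<tau>_def by (rule norm_ln_one_minus_remainder_le[OF small[OF z] K])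
      also have "\<dots> \<le> 2 * (R ^ K * (1 / norm \<zeta> ^ K))"
        using z by (simp add: norm_divide power_divide divide_right_mono power_mono)
      finally show ?thesis
        using bd[OF z] norm_triangle_ineq[of "\<rho> z" "\<tau> z"] by (simp add: algebra_simps)
    qed
    moreover have "(\<Prod>\<zeta>\<in>#add_mset \<zeta> Z. 1 - z / \<zeta>)
        = exp ((\<Sum>j=1..<K. b j * z ^ j) + (\<rho> z + \<tau> z))"
      if z: "z \<in> ball 0 R" for z
    proof -
      have "(\<Sum>j=1..<K. b j * z ^ j)
          = (\<Sum>j=1..<K. a j * z ^ j) - (\<Sum>j=1..<K. (z / \<zeta>) ^ j / of_nat j)"
        unfolding sum_subtractf[symmetric]
        by (intro sum.cong) (auto simp: b_def algebra_simps power_divide)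
      then have "(\<Sum>j=1..<K. b j * z ^ j) + (\<rho> z + \<tau> z)
          = ((\<Sum>j=1..<K. a j * z ^ j) + \<rho> z) + ln (1 - z / \<zeta>)"
        by (simp add: \<tau>_def)
      moreover have "1 - z / \<zeta> \<noteq> 0"
        using slit[OF z] by auto
      ultimately show ?thesis
    using eq[OF z] by (simp only: exp_add exp_Ln[OF \<open>1 - z / \<zeta> \<noteq> 0\<close>] image_mset_add_mset prod_mset.add_mset mult.commute)
    qed
    ultimately show ?case
      by blast
  qed
  then show ?thesis
    using that by blast
qed

lemma poly_eq_prod_one_minus:
  fixes p :: "complex poly"
  assumes "poly p 0 \<noteq> 0"
  shows "poly p z = poly p 0 * (\<Prod>\<zeta>\<in>#proots p. 1 - z / \<zeta>)"
proof -
  have p: "poly p z = lead_coeff p * (\<Prod>\<zeta>\<in>#proots p. z - \<zeta>)" for z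
    by (subst complex_poly_decompose_multiset[of p, symmetric])
       (simp add: poly_prod_mset image_mset.compositionality o_def)
  have "0 \<notin># proots p"
    using assms by (cases "p = 0") auto
  then have "(\<Prod>\<zeta>\<in>#proots p. z - \<zeta>) = (\<Prod>\<zeta>\<in>#proots p. (0 - \<zeta>) * (1 - z / \<zeta>))"
    by (intro arg_cong[of _ _ prod_mset] image_mset_cong) (auto simp: field_simps)
  also have "\<dots> = (\<Prod>\<zeta>\<in>#proots p. 0 - \<zeta>) * (\<Prod>\<zeta>\<in>#proots p. 1 - z / \<zeta>)"
    by (rule prod_mset.distrib)
  finally show ?thesis
    by (simp only: p[of z] p[of 0] mult.assoc)
qed

section \<open>Rigidity of the positivity inequality\<close>

text \<open>
  The inequality at first order forces \<open>f'(0)\<close> to be real, so it is inherited by the rest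
  \<open>g(w) = f(w) - f(0) - f'(0) w\<close>. If \<open>g(w) \<approx> c w\<^sup>n\<close> near \<open>0\<close> with \<open>c \<noteq> 0\<close> and \<open>n \<ge> 3\<close>, comparing
  the leading terms along the ray of angle \<open>\<alpha>\<close> gives \<open>Re (c e\<^bsup>in\<alpha>\<^esup>) \<le> (cos \<alpha>)\<^sup>n Re c\<close>. Among the
  \<open>n\<close> angles with \<open>c e\<^bsup>in\<alpha>\<^esup> = |c|\<close> at least one is not a multiple of \<open>\<pi>\<close>, and there the inequality
  fails. For \<open>n = 2\<close> both angles can be multiples of \<open>\<pi>\<close>.
\<close>

lemma holomorphic_affine_of_Re_le:
  fixes f :: "complex \<Rightarrow> complex"
  assumes hol: "f holomorphic_on ball 0 r" and r: "0 < r"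
    and le: "\<And>w. w \<in> ball 0 r \<Longrightarrow> Re (f w) \<le> Re (f (of_real (Re w)))"
    and d2: "(deriv ^^ 2) f 0 = 0"
    and w: "w \<in> ball 0 r"
  shows "f w = f 0 + deriv f 0 * w"
proof -
  define b where "b = deriv f 0"
  have Df: "(f has_field_derivative b) (at 0)"
    unfolding b_def using hol r by (simp add: holomorphic_derivI)
  have "Im b = 0"
  proof -
    have "((\<lambda>t. Re (f (\<i> * of_real t))) has_field_derivative Re (b * \<i>)) (at 0)"
    proof -
      have "((\<lambda>t. \<i> * of_real t) has_vector_derivative \<i>) (at (0::real))"
        by (auto intro!: derivative_eq_intros)
      from field_vector_diff_chain_at[OF this] Df
      have "((\<lambda>t. f (\<i> * of_real t)) has_vector_derivative \<i> * b) (at (0::real))"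
        by (simp add: o_def)
      from bounded_linear.has_vector_derivative[OF bounded_linear_Re this]
      show ?thesis
        by (simp add: has_real_derivative_iff_has_vector_derivative mult.commute)
    qed
    moreover have "Re (f (\<i> * of_real t)) \<le> Re (f (\<i> * of_real 0))" if "\<bar>0 - t\<bar> < r" for t
      using le[of "\<i> * of_real t"] that by (simp add: norm_mult)
    ultimately have "Re (b * \<i>) = 0"
      using DERIV_local_max[of _ "Re (b * \<i>)" 0 r] r by blast
    then show ?thesis by simp
  qed
  define g where "g w = f w - f 0 - b * w" for w
  have holg: "g holomorphic_on ball 0 r"
    unfolding g_def using hol by (intro holomorphic_intros)
  have gle: "Re (g w) \<le> Re (g (of_real (Re w)))" if "w \<in> ball 0 r" for w
    using le[OF that] \<open>Im b = 0\<close> by (simp add: g_def)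
  have "g w = 0"
  proof (rule ccontr)
    assume "g w \<noteq> 0"
    then obtain n0 where "(deriv ^^ n0) g 0 \<noteq> 0"
      using holomorphic_fun_eq_0_on_connected[OF holg, of 0 w] w r by auto
    then obtain n where n: "(deriv ^^ n) g 0 \<noteq> 0" and least: "\<And>i. i < n \<Longrightarrow> (deriv ^^ i) g 0 = 0"
      using exists_least_iff[of "\<lambda>n. (deriv ^^ n) g 0 \<noteq> 0"] by blast
    have dg: "deriv g w = deriv f w - b" if "w \<in> ball 0 r" for w
      unfolding g_def using holomorphic_derivI[OF hol _ that]
      by (intro DERIV_imp_deriv) (auto intro!: derivative_eq_intros)
    have ddg: "deriv (deriv g) 0 = deriv (deriv f) 0"
    proof -
      have "eventually (\<lambda>w. deriv g w = deriv f w - b) (nhds 0)"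
        using r dg by (auto intro!: eventually_nhds_in_open[THEN eventually_mono, of "ball 0 r"])
      then have "deriv (deriv g) 0 = deriv (\<lambda>w. deriv f w - b) 0"
        by (rule deriv_cong_ev) simp
      also have "\<dots> = deriv (deriv f) 0"
      proof -
        have "deriv f holomorphic_on ball 0 r"
          using hol by (intro holomorphic_deriv) auto
        from holomorphic_derivI[OF this] r show ?thesis
          by (intro DERIV_imp_deriv) (auto intro!: derivative_eq_intros)
      qed
      finally show ?thesis .
    qed
    have "g 0 = 0" "deriv g 0 = 0" "deriv (deriv g) 0 = 0"
      using dg[of 0] r ddg d2 by (simp_all add: g_def b_def numeral_2_eq_2)
    then have "n \<noteq> 0" "n \<noteq> 1" "n \<noteq> 2"
      using n by (auto simp: numeral_2_eq_2 intro: Nat.gr0I)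
    then have n3: "3 \<le> n" by simp
    have 0: "0 \<in> ball 0 r" "0 < n"
      using r n3 by auto
    have least': "(deriv ^^ i) g 0 = 0" if "0 < i" "i < n" for i
      using least that by blast
    obtain h \<delta> where \<delta>: "0 < \<delta>" and holh: "h holomorphic_on ball 0 \<delta>"
      and gh: "\<And>w. w \<in> ball 0 \<delta> \<Longrightarrow> g w - g 0 = (w - 0) ^ n * h w"
      and h0: "\<And>w. w \<in> ball 0 \<delta> \<Longrightarrow> h w \<noteq> 0"
      by (rule holomorphic_factor_order_of_zero[OF holg open_ball 0 n]) (rule least', assumption+, rule that)
    define c where "c = h 0"
    have "c \<noteq> 0" using h0 \<delta> by (simp add: c_def)
    have conth: "isCont h 0"
      using holh \<delta> by (metis centre_in_ball continuous_on_interior holomorphic_on_imp_continuous_on interior_open open_ball)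
    (* The inequality for g at x e^(i alpha), divided by x^n, in the limit x -> 0+. *)
    have dir: "Re (cis \<alpha> ^ n * c) \<le> cos \<alpha> ^ n * Re c" for \<alpha>
    proof -
      have 1: "((\<lambda>x. Re (cis \<alpha> ^ n * h (of_real x * cis \<alpha>))) \<longlongrightarrow> Re (cis \<alpha> ^ n * h 0)) (at_right (0::real))"
        by (intro tendsto_intros isCont_tendsto_compose[OF conth] tendsto_eq_intros) auto
      have 2: "((\<lambda>x. cos \<alpha> ^ n * Re (h (of_real (x * cos \<alpha>)))) \<longlongrightarrow> cos \<alpha> ^ n * Re (h 0)) (at_right (0::real))"
        by (intro tendsto_intros isCont_tendsto_compose[OF conth] tendsto_eq_intros) auto
      have "eventually (\<lambda>x::real. 0 < x \<and> x < min r \<delta>) (at_right 0)"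
        using r \<delta> by (auto simp: eventually_at_right_field intro!: exI[of _ "min r \<delta>"])
      then have 3: "eventually (\<lambda>x::real. Re (cis \<alpha> ^ n * h (of_real x * cis \<alpha>))
          \<le> cos \<alpha> ^ n * Re (h (of_real (x * cos \<alpha>)))) (at_right 0)"
      proof eventually_elim
        case (elim x)
        let ?w = "of_real x * cis \<alpha>"
        have cx: "\<bar>x * cos \<alpha>\<bar> \<le> x" using elim by (simp add: abs_mult mult_left_le)
        have "Re (g ?w) \<le> Re (g (of_real (x * cos \<alpha>)))"
          using gle[of ?w] elim by (simp add: norm_mult)
        moreover have "g ?w = of_real (x ^ n) * (cis \<alpha> ^ n * h ?w)"
          using gh[of ?w] elim \<open>g 0 = 0\<close> by (simp add: norm_mult power_mult_distrib)
        moreover have "g (of_real (x * cos \<alpha>)) = of_real (x ^ n * cos \<alpha> ^ n) * h (of_real (x * cos \<alpha>))"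
          using gh[of "of_real (x * cos \<alpha>)"] elim cx \<open>g 0 = 0\<close> by (simp flip: power_mult_distrib del: of_real_mult)
        ultimately have "x ^ n * Re (cis \<alpha> ^ n * h ?w) \<le> x ^ n * (cos \<alpha> ^ n * Re (h (of_real (x * cos \<alpha>))))"
          by (simp only: Re_complex_of_real Im_complex_of_real times_complex.sel mult.assoc)
        then show ?case
          using elim by (simp add: mult_le_cancel_left_pos)
      qed
      show ?thesis
        unfolding c_def using tendsto_le[OF _ 2 1 3] by simp
    qed
    (* A direction in which the leading term attains its maximal modulus has to be real. *)
    have key: "sin \<alpha> = 0" if "cis \<alpha> ^ n * c = of_real (norm c)" for \<alpha>
    proof (rule ccontr)
      assume "sin \<alpha> \<noteq> 0"
      then have "\<bar>cos \<alpha>\<bar> < 1"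
        using sin_cos_squared_add[of \<alpha>] by (metis abs_cos_le_one add_cancel_left_left less_eq_real_def one_power2 power2_abs zero_eq_power2 add.commute)
      then have "\<bar>cos \<alpha>\<bar> ^ n < 1" using n3 by (simp add: power_less_one_iff)
      have "norm c \<le> cos \<alpha> ^ n * Re c" using dir[of \<alpha>] that by simp
      also have "\<dots> \<le> \<bar>cos \<alpha>\<bar> ^ n * \<bar>Re c\<bar>" by (metis abs_ge_self abs_mult power_abs)
      also have "\<dots> \<le> \<bar>cos \<alpha>\<bar> ^ n * norm c" by (simp add: abs_Re_le_cmod mult_left_mono)
      also have "\<dots> < 1 * norm c" using \<open>\<bar>cos \<alpha>\<bar> ^ n < 1\<close> \<open>c \<noteq> 0\<close> by (intro mult_strict_right_mono) auto
      finally show False by simp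
    qed
    (* The angles alpha and alpha + 2 pi / n cannot both be multiples of pi, as n >= 3. *)
    define \<alpha> where "\<alpha> = - Arg c / n"
    have c: "c = of_real (norm c) * cis (Arg c)"
      using rcis_cmod_Arg[of c] by (simp add: rcis_def)
    have "cis \<alpha> ^ n = cis (- Arg c)"
      using n3 by (simp only: Complex.DeMoivre) (simp add: \<alpha>_def)
    then have "cis \<alpha> ^ n * c = of_real (norm c)"
      by (subst c) (simp add: cis_mult)
    moreover have "cis (\<alpha> + 2 * pi / n) ^ n = cis \<alpha> ^ n"
    proof -
      have "real n * (\<alpha> + 2 * pi / n) = real n * \<alpha> + 2 * pi" using n3 by (simp add: field_simps)
      then have "cis (\<alpha> + 2 * pi / n) ^ n = cis (n * \<alpha>) * cis (2 * pi)"
        by (simp only: Complex.DeMoivre cis_mult)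
      then show ?thesis
        by (simp add: Complex.DeMoivre)
    qed
    ultimately have s: "sin \<alpha> = 0" "sin (\<alpha> + 2 * pi / n) = 0"
      using key by auto
    then have "sin (2 * pi / n) = 0"
      using sin_cos_squared_add[of \<alpha>] by (auto simp: sin_add)
    moreover have "0 < 2 * pi / n" "2 * pi / n < pi"
      using n3 by (auto simp: divide_simps)
    ultimately show False
      using sin_gt_zero by force
  qed
  then show ?thesis by (simp add: g_def b_def algebra_simps)
qed

section \<open>Exponential sums\<close>

text \<open>
  This form serves two purposes: for a probability vector \<open>c\<close> it is a moment generating
  function, and for arbitrary \<open>c\<close> it is a polynomial in \<open>e\<^sup>w\<close>, such as the main part of the
  logarithm of a moment generating function.
\<close>

definition exp_sum :: "(nat \<Rightarrow> complex) \<Rightarrow> nat set \<Rightarrow> complex \<Rightarrow> complex" where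
  "exp_sum c J w = (\<Sum>j\<in>J. c j * exp (of_nat j * w))"

lemma exp_sum_has_field_derivative [derivative_intros]:
  "(exp_sum c J has_field_derivative exp_sum (\<lambda>j. of_nat j * c j) J w) (at w within S)"
  unfolding exp_sum_def [abs_def]
  by (auto intro!: derivative_eq_intros sum.cong)

lemma deriv_exp_sum: "deriv (exp_sum c J) = exp_sum (\<lambda>j. of_nat j * c j) J"
  by (rule ext, rule DERIV_imp_deriv) (rule exp_sum_has_field_derivative)

lemma holomorphic_on_exp_sum [holomorphic_intros]: "exp_sum c J holomorphic_on S"
  by (auto simp: holomorphic_on_def field_differentiable_def intro: exp_sum_has_field_derivative)

lemma exp_sum_at_0: "exp_sum c J 0 = sum c J"
  by (simp add: exp_sum_def)

text \<open>
  The derivative of the sum is a polynomial in \<open>e\<^sup>w\<close> that equals \<open>\<beta>\<close> for infinitely many values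
  of \<open>e\<^sup>w\<close>, so all its coefficients of positive index vanish.
\<close>

lemma exp_sum_eq_affineD:
  assumes J: "finite J" "0 \<notin> J" and r: "0 < r"
    and eq: "\<And>w. w \<in> ball 0 r \<Longrightarrow> exp_sum c J w = \<alpha> + \<beta> * w"
    and j: "j \<in> J"
  shows "c j = 0"
proof -
  define p where "p = (\<Sum>j\<in>J. monom (of_nat j * c j) j) - [:\<beta>:]"
  have "poly p (exp w) = 0" if w: "w \<in> ball 0 r" for w
  proof -
    have "exp_sum (\<lambda>j. of_nat j * c j) J w = \<beta>"
    proof (rule DERIV_unique)
      show "(exp_sum c J has_field_derivative exp_sum (\<lambda>j. of_nat j * c j) J w) (at w)"
        by (rule exp_sum_has_field_derivative)
      have "((\<lambda>w. \<alpha> + \<beta> * w) has_field_derivative \<beta>) (at w)"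
        by (auto intro!: derivative_eq_intros)
      then show "(exp_sum c J has_field_derivative \<beta>) (at w)"
        by (rule has_field_derivative_transform_within_open[OF _ open_ball w]) (simp add: eq)
    qed
    then show ?thesis
      by (simp add: p_def poly_sum poly_monom exp_sum_def exp_of_nat_mult mult.assoc)
  qed
  then have "(\<lambda>x. exp (complex_of_real x)) ` {0<..<r} \<subseteq> {z. poly p z = 0}"
    by auto
  moreover have "infinite ((\<lambda>x. exp (complex_of_real x)) ` {0<..<r})"
    using r by (subst finite_image_iff) (auto simp: inj_on_def exp_of_real infinite_Ioo)
  ultimately have "p = 0"
    using poly_roots_finite finite_subset by blast
  moreover have "coeff p j = of_nat j * c j"
    using J j by (auto simp: p_def coeff_sum coeff_pCons if_distrib cong: if_cong split: nat.splits)
  ultimately show ?thesis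
    using J j by auto
qed

text \<open>
  The quantitative form of rigidity. The constant \<open>\<epsilon>\<close> comes from compactness: counterexamples
  for \<open>\<epsilon> \<rightarrow> 0\<close>, normalised so that their coefficients have absolute sum \<open>1\<close>, would have a limit
  that satisfies the inequality exactly and has second derivative \<open>0\<close> at \<open>0\<close>, hence is affine, hence
  has zero coefficients, contradicting the normalisation.
\<close>

lemma exp_sum_coeffs_bound:
  fixes J :: "nat set"
  assumes J: "finite J" "0 \<notin> J"
  obtains \<epsilon> :: real where "0 < \<epsilon>"
    and "\<And>a. (\<And>w. w \<in> ball 0 1 \<Longrightarrow> Re (exp_sum a J w)
            \<le> Re (exp_sum a J (of_real (Re w))) + \<epsilon> * (\<Sum>j\<in>J. norm (a j)))
          \<Longrightarrow> \<epsilon> * (\<Sum>j\<in>J. norm (a j)) \<le> norm (\<Sum>j\<in>J. of_nat (j\<^sup>2) * a j)"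
proof (rule ccontr)
  note bound = that
  assume "\<not> thesis"
  let ?S = "\<lambda>a. \<Sum>j\<in>J. norm (a j)"
  have "\<exists>a. (\<forall>w\<in>ball 0 1. Re (exp_sum a J w) \<le> Re (exp_sum a J (of_real (Re w))) + \<epsilon> * ?S a) \<and>
      norm (\<Sum>j\<in>J. of_nat (j\<^sup>2) * a j) < \<epsilon> * ?S a" (is "\<exists>a. ?P a") if \<epsilon>: "0 < \<epsilon>" for \<epsilon>
  proof (rule ccontr)
    assume no: "\<not> (\<exists>a. ?P a)"
    have thesis
    proof (rule bound[OF \<epsilon>])
      fix a assume "\<And>w. w \<in> ball 0 1 \<Longrightarrow> Re (exp_sum a J w) \<le> Re (exp_sum a J (of_real (Re w))) + \<epsilon> * ?S a"
      with no show "\<epsilon> * ?S a \<le> norm (\<Sum>j\<in>J. of_nat (j\<^sup>2) * a j)"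
        by (meson not_less)
    qed
    with \<open>\<not> thesis\<close> show False ..
  qed
  then have "\<forall>m. \<exists>a. (\<forall>w\<in>ball 0 1. Re (exp_sum a J w) \<le> Re (exp_sum a J (of_real (Re w))) + inverse (real (Suc m)) * ?S a) \<and>
      norm (\<Sum>j\<in>J. of_nat (j\<^sup>2) * a j) < inverse (real (Suc m)) * ?S a"
    by simp
  from choice[OF this] obtain a where a_all: "\<forall>m. (\<forall>w\<in>ball 0 1. Re (exp_sum (a m) J w) \<le> Re (exp_sum (a m) J (of_real (Re w))) + inverse (real (Suc m)) * ?S (a m)) \<and>
      norm (\<Sum>j\<in>J. of_nat (j\<^sup>2) * a m j) < inverse (real (Suc m)) * ?S (a m)"
    by (rule exE) (rule that)
  have a: "Re (exp_sum (a m) J w) \<le> Re (exp_sum (a m) J (of_real (Re w))) + inverse (real (Suc m)) * ?S (a m)"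
    if "w \<in> ball 0 1" for m w
    using a_all[THEN spec, of m, THEN conjunct1] that by (rule bspec)
  have a2: "norm (\<Sum>j\<in>J. of_nat (j\<^sup>2) * a m j) < inverse (real (Suc m)) * ?S (a m)" for m
    using a_all[THEN spec, of m] by (rule conjunct2)
  have S: "0 < ?S (a m)" for m
  proof -
    have "0 < inverse (real (Suc m)) * ?S (a m)"
      using a2[of m] by (rule le_less_trans[OF norm_ge_zero])
    then show ?thesis
      by (rule zero_less_mult_pos) simp
  qed
  define b where "b m j = a m j / of_real (?S (a m))" for m j
  have b_sum: "?S (b m) = 1" for m
    using S[of m] by (simp add: b_def norm_divide sum_divide_distrib[symmetric] del: of_real_sum)
  have b_exp: "exp_sum (b m) J w = exp_sum (a m) J w / of_real (?S (a m))" for m w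
    by (simp add: b_def exp_sum_def sum_divide_distrib)
  have b: "Re (exp_sum (b m) J w) \<le> Re (exp_sum (b m) J (of_real (Re w))) + inverse (real (Suc m))"
    if "w \<in> ball 0 1" for m w
  proof -
    have "Re (exp_sum (a m) J w) / ?S (a m)
        \<le> (Re (exp_sum (a m) J (of_real (Re w))) + inverse (real (Suc m)) * ?S (a m)) / ?S (a m)"
      using a[OF that, of m] S[of m] by (intro divide_right_mono) auto
    then show ?thesis
      using S[of m] by (simp add: b_exp Re_divide_of_real add_divide_distrib del: of_real_sum)
  qed
  have b2: "norm (\<Sum>j\<in>J. of_nat (j\<^sup>2) * b m j) \<le> inverse (real (Suc m))" for m
  proof -
    have "(\<Sum>j\<in>J. of_nat (j\<^sup>2) * b m j) = (\<Sum>j\<in>J. of_nat (j\<^sup>2) * a m j) / of_real (?S (a m))"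
      by (simp add: b_def sum_divide_distrib)
    then show ?thesis
      using a2[of m] S[of m] by (simp add: norm_divide pos_divide_le_eq del: of_real_sum)
  qed
  have "norm (b m j) \<le> 1" if "j \<in> J" for m j
    using member_le_sum[OF that, of "\<lambda>j. norm (b m j)"] J b_sum[of m] by simp
  then obtain k where k: "strict_mono k" and "\<And>j. j \<in> J \<Longrightarrow> \<exists>l. (\<lambda>n. b (k n) j) \<longlonglongrightarrow> l"
    using function_convergent_subsequence[of J b 1] J countable_finite by blast
  then obtain c where c: "\<And>j. j \<in> J \<Longrightarrow> (\<lambda>n. b (k n) j) \<longlonglongrightarrow> c j"
    by metis
  have inv0: "(\<lambda>n. inverse (real (Suc (k n)))) \<longlonglongrightarrow> 0"
    using LIMSEQ_subseq_LIMSEQ[OF LIMSEQ_inverse_real_of_nat k] by (simp add: o_def)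
  have c_exp: "(\<lambda>n. exp_sum (b (k n)) J w) \<longlonglongrightarrow> exp_sum c J w" for w
    unfolding exp_sum_def by (intro tendsto_intros c)
  have c_Re: "Re (exp_sum c J w) \<le> Re (exp_sum c J (of_real (Re w)))" if "w \<in> ball 0 1" for w
  proof (rule tendsto_le)
    show "(\<lambda>n. Re (exp_sum (b (k n)) J w)) \<longlonglongrightarrow> Re (exp_sum c J w)"
      by (intro tendsto_intros c_exp)
    show "(\<lambda>n. Re (exp_sum (b (k n)) J (of_real (Re w))) + inverse (real (Suc (k n))))
        \<longlonglongrightarrow> Re (exp_sum c J (of_real (Re w)))"
      using tendsto_add[OF tendsto_Re[OF c_exp] inv0] by simp
  qed (use b[OF that] in auto)
  have c2: "(\<Sum>j\<in>J. of_nat (j\<^sup>2) * c j) = 0"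
  proof (rule LIMSEQ_unique)
    show "(\<lambda>n. \<Sum>j\<in>J. of_nat (j\<^sup>2) * b (k n) j) \<longlonglongrightarrow> (\<Sum>j\<in>J. of_nat (j\<^sup>2) * c j)"
      by (intro tendsto_intros c)
    show "(\<lambda>n. \<Sum>j\<in>J. of_nat (j\<^sup>2) * b (k n) j) \<longlonglongrightarrow> 0"
      by (rule Lim_null_comparison[OF _ inv0]) (use b2 in auto)
  qed
  have "?S c = 1"
  proof (rule LIMSEQ_unique)
    show "(\<lambda>n. ?S (b (k n))) \<longlonglongrightarrow> ?S c"
      by (intro tendsto_intros c)
    show "(\<lambda>n. ?S (b (k n))) \<longlonglongrightarrow> 1"
      by (simp add: b_sum)
  qed
  moreover have "c j = 0" if "j \<in> J" for j
  proof (rule exp_sum_eq_affineD[OF J zero_less_one _ that])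
    fix w :: complex assume w: "w \<in> ball 0 1"
    have "(deriv ^^ 2) (exp_sum c J) 0 = 0"
      using c2 by (simp add: numeral_2_eq_2 deriv_exp_sum exp_sum_at_0 mult.assoc)
    from holomorphic_affine_of_Re_le[OF holomorphic_on_exp_sum zero_less_one c_Re this w]
    show "exp_sum c J w = exp_sum c J 0 + deriv (exp_sum c J) 0 * w" .
  qed
  ultimately show False by simp
qed

section \<open>Cauchy and Taylor estimates on the unit disc\<close>

lemma norm_deriv_le_of_bounded:
  fixes f :: "complex \<Rightarrow> complex"
  assumes hol: "f holomorphic_on ball 0 1" and bd: "\<And>w. w \<in> ball 0 1 \<Longrightarrow> norm (f w) \<le> B"
    and x: "norm x \<le> 1 / 2"
  shows "norm ((deriv ^^ m) f x) \<le> fact m * B * 4 ^ m"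
proof -
  have sub: "cball x (1 / 4) \<subseteq> ball 0 1"
  proof
    fix y assume "y \<in> cball x (1 / 4)"
    then show "y \<in> ball 0 1"
      using x norm_triangle_sub[of y x] by (auto simp: dist_norm norm_minus_commute)
  qed
  have "norm ((deriv ^^ m) f x) \<le> fact m * B / (1 / 4) ^ m"
  proof (rule Cauchy_inequality)
    show "f holomorphic_on ball x (1 / 4)"
      using hol sub ball_subset_cball by (blast intro: holomorphic_on_subset)
    show "continuous_on (cball x (1 / 4)) f"
      using hol sub by (blast intro: holomorphic_on_imp_continuous_on holomorphic_on_subset)
    show "norm (f y) \<le> B" if "norm (x - y) = 1 / 4" for y
    proof (rule bd)
      have "y \<in> cball x (1 / 4)"
        using that by (simp add: dist_norm)
      then show "y \<in> ball 0 1"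
        using sub by blast
    qed
  qed simp
  then show ?thesis
    by (simp add: power_divide)
qed

lemma norm_taylor2_remainder_le:
  fixes f :: "complex \<Rightarrow> complex"
  assumes hol: "f holomorphic_on ball 0 1" and bd: "\<And>w. w \<in> ball 0 1 \<Longrightarrow> norm (f w) \<le> B"
    and w: "norm w \<le> 1 / 2"
  shows "norm (f w - (f 0 + deriv f 0 * w + deriv (deriv f) 0 * w\<^sup>2 / 2)) \<le> 192 * B * norm w ^ 3"
proof -
  have "norm ((deriv ^^ 0) f w - (\<Sum>i\<le>2. (deriv ^^ i) f 0 * (w - 0) ^ i / fact i))
      \<le> 384 * B * norm (w - 0) ^ Suc 2 / fact 2"
  proof (rule complex_Taylor[where S = "cball 0 (1 / 2)"])
    fix i x assume x: "x \<in> cball (0::complex) (1 / 2)"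
    then have "x \<in> ball 0 1" by simp
    then show "((deriv ^^ i) f has_field_derivative (deriv ^^ Suc i) f x) (at x within cball 0 (1 / 2))"
      using has_field_derivative_higher_deriv[OF hol open_ball] has_field_derivative_at_within by blast
    show "norm ((deriv ^^ Suc 2) f x) \<le> 384 * B"
      using norm_deriv_le_of_bounded[OF hol bd, where m = 3 and x = x] x by (simp add: fact_numeral numeral_3_eq_3)
  qed (use w in auto)
  then show ?thesis
    by (simp add: numeral_2_eq_2 numeral_3_eq_3 algebra_simps)
qed

section \<open>The cumulant generating function is controlled by the variance\<close>

text \<open>For a probability vector \<open>c\<close>, these are the mean and the variance as first cumulants.\<close>

lemma log_exp_sum_derivs:
  assumes hol: "G holomorphic_on ball 0 r" and r: "0 < r"
    and eq: "\<And>w. w \<in> ball 0 r \<Longrightarrow> exp (G w) = exp_sum c J w" and c: "sum c J = 1"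
  shows "deriv G 0 = (\<Sum>j\<in>J. of_nat j * c j)"
    and "deriv (deriv G) 0 = (\<Sum>j\<in>J. of_nat (j\<^sup>2) * c j) - (\<Sum>j\<in>J. of_nat j * c j)\<^sup>2"
proof -
  let ?c1 = "\<lambda>j. of_nat j * c j"
  let ?c2 = "\<lambda>j. of_nat j * (of_nat j * c j)"
  have nz: "exp_sum c J w \<noteq> 0" if "w \<in> ball 0 r" for w
    using eq[OF that] exp_not_eq_zero[of "G w"] by simp
  have G1: "deriv G w = exp_sum ?c1 J w / exp_sum c J w" if w: "w \<in> ball 0 r" for w
  proof -
    have "((\<lambda>w. exp (G w)) has_field_derivative exp (G w) * deriv G w) (at w)"
      using holomorphic_derivI[OF hol open_ball w] by (auto intro!: derivative_eq_intros)
    then have "(exp_sum c J has_field_derivative exp (G w) * deriv G w) (at w)"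
      by (rule has_field_derivative_transform_within_open[OF _ open_ball w]) (simp add: eq)
    then have "exp_sum c J w * deriv G w = exp_sum ?c1 J w"
      using DERIV_unique[OF exp_sum_has_field_derivative] eq[OF w] by simp
    then show ?thesis
      using nz[OF w] by (simp add: field_simps)
  qed
  have 0: "0 \<in> ball 0 r"
    using r by simp
  show "deriv G 0 = (\<Sum>j\<in>J. of_nat j * c j)"
    using G1[OF 0] by (simp add: exp_sum_at_0 c)
  have "((\<lambda>w. exp_sum ?c1 J w / exp_sum c J w) has_field_derivative
      (exp_sum ?c2 J 0 * exp_sum c J 0 - exp_sum ?c1 J 0 * exp_sum ?c1 J 0) / (exp_sum c J 0 * exp_sum c J 0)) (at 0)"
    using nz[OF 0] by (intro DERIV_divide exp_sum_has_field_derivative)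
  then have "(deriv G has_field_derivative sum ?c2 J - (sum ?c1 J)\<^sup>2) (at 0)"
    by (rule has_field_derivative_transform_within_open[OF _ open_ball 0, THEN DERIV_cong])
       (simp_all add: G1 exp_sum_at_0 c power2_eq_square)
  then show "deriv (deriv G) 0 = (\<Sum>j\<in>J. of_nat (j\<^sup>2) * c j) - (\<Sum>j\<in>J. of_nat j * c j)\<^sup>2"
    by (simp add: DERIV_imp_deriv power2_eq_square mult.assoc)
qed

lemma sum_weighted_variance:
  fixes p x :: "'i \<Rightarrow> real"
  assumes "sum p J = 1" and "(\<Sum>j\<in>J. p j * x j) = m"
  shows "(\<Sum>j\<in>J. p j * (x j - m)\<^sup>2) = (\<Sum>j\<in>J. p j * (x j)\<^sup>2) - m\<^sup>2"
proof -
  have "(\<Sum>j\<in>J. p j * (x j - m)\<^sup>2)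
      = (\<Sum>j\<in>J. p j * (x j)\<^sup>2) - 2 * m * (\<Sum>j\<in>J. p j * x j) + m\<^sup>2 * sum p J"
    unfolding sum_distrib_left sum_subtractf[symmetric] sum.distrib[symmetric]
    by (intro sum.cong) (auto simp: power2_eq_square algebra_simps)
  then show ?thesis
    by (simp add: assms power2_eq_square)
qed

text \<open>
  The radius \<open>3\<close> contains \<open>e\<^sup>w\<close> for \<open>|w| < 1\<close>, and roots outside the radius \<open>6\<close> keep \<open>|z / \<zeta>| \<le> 1/2\<close>
  there. With \<open>S\<close> the absolute sum of the polynomial coefficients and \<open>D\<close> the bound for the
  remainder, either \<open>S\<close> is itself of the order of \<open>D\<close>, or the remainder is negligible
  against \<open>S\<close> and the polynomial part inherits the inequality \<open>Re G(w) \<le> Re G(Re w)\<close> well enough for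
  the quantitative rigidity to bound \<open>S\<close> by the variance.
\<close>

lemma log_mgf_bounded_by_variance:
  fixes K :: nat
  assumes K: "1 \<le> K"
  obtains C :: real where "0 \<le> C"
    and "\<And>p N. \<lbrakk>\<And>j. 0 \<le> p j; (\<Sum>j\<le>N. p j) = 1;
           \<And>\<zeta>. \<zeta> \<in># proots (\<Sum>j\<le>N. monom (complex_of_real (p j)) j) \<Longrightarrow> 6 \<le> norm \<zeta>;
           (\<Sum>\<zeta>\<in>#proots (\<Sum>j\<le>N. monom (complex_of_real (p j)) j). 1 / norm \<zeta> ^ K) \<le> 1\<rbrakk>
         \<Longrightarrow> \<exists>G. G holomorphic_on ball 0 1 \<and> G 0 = 0 \<and>
             (\<forall>w\<in>ball 0 1. exp (G w) = exp_sum (\<lambda>j. of_real (p j)) {..N} w) \<and>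
             (\<forall>w\<in>ball 0 1. norm (G w)
                \<le> C * (1 + ((\<Sum>j\<le>N. p j * (real j)\<^sup>2) - (\<Sum>j\<le>N. p j * real j)\<^sup>2)))"
proof -
  define J where "J = {1..<K}"
  have J: "finite J" "0 \<notin> J" by (auto simp: J_def)
  from exp_sum_coeffs_bound[OF J] obtain \<epsilon> :: real where \<epsilon>: "0 < \<epsilon>"
    and coeffs: "\<And>a. (\<And>w. w \<in> ball 0 1 \<Longrightarrow> Re (exp_sum a J w)
            \<le> Re (exp_sum a J (of_real (Re w))) + \<epsilon> * (\<Sum>j\<in>J. norm (a j)))
          \<Longrightarrow> \<epsilon> * (\<Sum>j\<in>J. norm (a j)) \<le> norm (\<Sum>j\<in>J. of_nat (j\<^sup>2) * a j)"
    by blast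
  define D :: real where "D = 2 * 3 ^ K"
  have D: "0 \<le> D" by (simp add: D_def)
  define C where "C = 2 * 3 ^ K * ((1 + 68 * D) / \<epsilon>) + 2 * D"
  have "0 \<le> C" using \<epsilon> D by (simp add: C_def)
  then show thesis
  proof (rule that)
    fix p :: "nat \<Rightarrow> real" and N :: nat
    let ?P = "\<Sum>j\<le>N. monom (complex_of_real (p j)) j"
    assume p: "\<And>j. 0 \<le> p j" and p1: "(\<Sum>j\<le>N. p j) = 1"
      and roots: "\<And>\<zeta>. \<zeta> \<in># proots ?P \<Longrightarrow> 6 \<le> norm \<zeta>"
      and sum_roots: "(\<Sum>\<zeta>\<in>#proots ?P. 1 / norm \<zeta> ^ K) \<le> 1"
    define \<phi> where "\<phi> = exp_sum (\<lambda>j. complex_of_real (p j)) {..N}"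
    define v where "v = (\<Sum>j\<le>N. p j * (real j)\<^sup>2) - (\<Sum>j\<le>N. p j * real j)\<^sup>2"
    have "v = (\<Sum>j\<le>N. p j * (real j - (\<Sum>j\<le>N. p j * real j))\<^sup>2)"
      unfolding v_def by (rule sum_weighted_variance[OF p1 refl, symmetric])
    then have v: "0 \<le> v" by (simp add: sum_nonneg p)
    have P_exp: "poly ?P (exp w) = \<phi> w" for w
      by (simp add: \<phi>_def exp_sum_def poly_sum poly_monom exp_of_nat_mult)
    have \<phi>0: "\<phi> 0 = 1"
      using p1 by (simp add: \<phi>_def exp_sum_at_0 flip: of_real_sum)
    have P1: "poly ?P 1 = 1"
      using P_exp[of 0] \<phi>0 by simp
    have P0: "poly ?P 0 \<noteq> 0"
    proof
      assume "poly ?P 0 = 0"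
      moreover have "?P \<noteq> 0" using P1 by auto
      ultimately have "0 \<in># proots ?P" by simp
      from roots[OF this] show False by simp
    qed
    have "2 * 3 \<le> norm \<zeta>" if "\<zeta> \<in># proots ?P" for \<zeta>
      using roots[OF that] by simp
    note roots2 = this
    obtain a \<rho> where hol_\<rho>: "\<rho> holomorphic_on ball 0 3"
      and \<rho>: "\<And>z. z \<in> ball 0 3 \<Longrightarrow> norm (\<rho> z) \<le> 2 * 3 ^ K * (\<Sum>\<zeta>\<in>#proots ?P. 1 / norm \<zeta> ^ K)"
      and prod: "\<And>z. z \<in> ball 0 3 \<Longrightarrow>
        (\<Prod>\<zeta>\<in>#proots ?P. 1 - z / \<zeta>) = exp ((\<Sum>j=1..<K. a j * z ^ j) + \<rho> z)"
      by (rule prod_one_minus_eq_exp[of 3 K "proots ?P"]) (simp, rule K, erule roots2, rule that)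
    have \<rho>D: "norm (\<rho> z) \<le> D" if "z \<in> ball 0 3" for z
    proof -
      have "norm (\<rho> z) \<le> D * (\<Sum>\<zeta>\<in>#proots ?P. 1 / norm \<zeta> ^ K)"
        using \<rho>[OF that] by (simp add: D_def)
      also have "\<dots> \<le> D * 1"
        using sum_roots D by (rule mult_left_mono)
      finally show ?thesis by simp
    qed
    have exp_le3: "norm (exp w) < 3" if "w \<in> ball 0 1" for w :: complex
    proof -
      have "Re w < 1" using that complex_Re_le_cmod[of w] by simp
      then have "norm (exp w) < exp 1" by (simp add: norm_exp_eq_Re)
      then show ?thesis using exp_le by linarith
    qed
    define r where "r w = \<rho> (exp w) - \<rho> 1" for w
    define G where "G w = exp_sum a J w - exp_sum a J 0 + r w" for w
    have hol_r: "r holomorphic_on ball 0 1"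
    proof -
      have "(\<rho> \<circ> exp) holomorphic_on ball 0 1"
        by (rule holomorphic_on_compose_gen[OF holomorphic_on_exp hol_\<rho>]) (use exp_le3 in auto)
      then show ?thesis
        unfolding r_def [abs_def] o_def by (rule holomorphic_on_diff) (rule holomorphic_on_const)
    qed
    have hol_G: "G holomorphic_on ball 0 1"
      unfolding G_def [abs_def] using hol_r by (intro holomorphic_intros)
    have r_le: "norm (r w) \<le> 2 * D" if "w \<in> ball 0 1" for w
      using \<rho>D[of "exp w"] \<rho>D[of 1] exp_le3[OF that] norm_triangle_ineq4[of "\<rho> (exp w)" "\<rho> 1"]
      by (simp add: r_def)
    have \<phi>_eq: "\<phi> w = poly ?P 0 * exp (exp_sum a J w + \<rho> (exp w))" if "w \<in> ball 0 1" for w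
    proof -
      have "\<phi> w = poly ?P 0 * (\<Prod>\<zeta>\<in>#proots ?P. 1 - exp w / \<zeta>)"
        unfolding P_exp[symmetric] by (rule poly_eq_prod_one_minus[OF P0])
      also have "(\<Prod>\<zeta>\<in>#proots ?P. 1 - exp w / \<zeta>) = exp ((\<Sum>j=1..<K. a j * exp w ^ j) + \<rho> (exp w))"
        using exp_le3[OF that] by (intro prod) simp
      also have "(\<Sum>j=1..<K. a j * exp w ^ j) = exp_sum a J w"
        by (simp add: exp_sum_def J_def exp_of_nat_mult)
      finally show ?thesis .
    qed
    have exp_G: "exp (G w) = \<phi> w" if "w \<in> ball 0 1" for w
    proof -
      have "G w = (exp_sum a J w + \<rho> (exp w)) - (exp_sum a J 0 + \<rho> 1)"
        by (simp add: G_def r_def)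
      then have "exp (G w) = \<phi> w / \<phi> 0"
        using \<phi>_eq[OF that] \<phi>_eq[of 0] P0 by (simp add: exp_diff)
      then show ?thesis by (simp add: \<phi>0)
    qed
    (* Nonnegativity of the weights enters here: |phi(w)| <= phi(Re w). *)
    have G_Re: "Re (G w) \<le> Re (G (of_real (Re w)))" if w: "w \<in> ball 0 1" for w
    proof -
      let ?x = "complex_of_real (Re w)"
      have x: "?x \<in> ball 0 1"
        using w abs_Re_le_cmod[of w] by simp
      have "norm (\<phi> w) \<le> (\<Sum>j\<le>N. p j * exp (real j * Re w))"
        unfolding \<phi>_def exp_sum_def
        by (rule order_trans[OF norm_sum]) (simp add: norm_mult norm_exp_eq_Re p)
      also have "\<phi> ?x = of_real (\<Sum>j\<le>N. p j * exp (real j * Re w))"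
        by (simp add: \<phi>_def exp_sum_def flip: exp_of_real)
      then have "(\<Sum>j\<le>N. p j * exp (real j * Re w)) = norm (\<phi> ?x)"
        by (simp add: sum_nonneg p del: of_real_sum)
      finally have "norm (exp (G w)) \<le> norm (exp (G ?x))"
        by (simp add: exp_G[OF w] exp_G[OF x])
      then show ?thesis by (simp add: norm_exp_eq_Re)
    qed
    define S where "S = (\<Sum>j\<in>J. norm (a j))"
    have "\<epsilon> * S \<le> v + 68 * D"
    proof (cases "4 * D \<le> \<epsilon> * S")
      case True
      (* Replacing G by its polynomial part changes each side by at most 2 D. *)
      have "Re (exp_sum a J w) \<le> Re (exp_sum a J (of_real (Re w))) + \<epsilon> * S" if w: "w \<in> ball 0 1" for w
      proof -
        let ?x = "complex_of_real (Re w)"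
        have x: "?x \<in> ball 0 1"
          using w abs_Re_le_cmod[of w] by simp
        have "\<bar>Re (r w)\<bar> \<le> 2 * D" "\<bar>Re (r ?x)\<bar> \<le> 2 * D"
          using r_le[OF w] r_le[OF x] abs_Re_le_cmod order_trans by blast+
        then show ?thesis
          using G_Re[OF w] True by (simp add: G_def)
      qed
      then have "\<epsilon> * S \<le> norm (\<Sum>j\<in>J. of_nat (j\<^sup>2) * a j)"
        unfolding S_def by (rule coeffs)
      also have "(\<Sum>j\<in>J. of_nat (j\<^sup>2) * a j) = of_real v - deriv (deriv r) 0"
      proof -
        have "deriv (deriv G) 0 = (\<Sum>j\<le>N. of_nat (j\<^sup>2) * of_real (p j)) - (\<Sum>j\<le>N. of_nat j * of_real (p j))\<^sup>2"
          using exp_G p1 by (intro log_exp_sum_derivs(2)[OF hol_G zero_less_one]) (auto simp: \<phi>_def simp flip: of_real_sum)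
        also have "\<dots> = of_real v"
          by (simp add: v_def mult.commute)
        finally have "deriv (deriv G) 0 = of_real v" .
        moreover have "deriv (deriv G) 0 = (\<Sum>j\<in>J. of_nat (j\<^sup>2) * a j) + deriv (deriv r) 0"
        proof (rule DERIV_imp_deriv)
          have dG: "deriv G w = exp_sum (\<lambda>j. of_nat j * a j) J w + deriv r w" if "w \<in> ball 0 1" for w
            unfolding G_def [abs_def] using holomorphic_derivI[OF hol_r open_ball that]
            by (intro DERIV_imp_deriv) (auto intro!: derivative_eq_intros)
          have "deriv r holomorphic_on ball 0 1"
            using hol_r by (intro holomorphic_deriv) auto
          from holomorphic_derivI[OF this open_ball, of 0]
          have "((\<lambda>w. exp_sum (\<lambda>j. of_nat j * a j) J w + deriv r w) has_field_derivative
              exp_sum (\<lambda>j. of_nat j * (of_nat j * a j)) J 0 + deriv (deriv r) 0) (at 0)"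
            by (intro DERIV_add exp_sum_has_field_derivative) simp
          then have "(deriv G has_field_derivative
              exp_sum (\<lambda>j. of_nat j * (of_nat j * a j)) J 0 + deriv (deriv r) 0) (at 0)"
            by (rule has_field_derivative_transform_within_open[OF _ open_ball[of 0 1]]) (auto simp: dG)
          then show "(deriv G has_field_derivative (\<Sum>j\<in>J. of_nat (j\<^sup>2) * a j) + deriv (deriv r) 0) (at 0)"
            by (simp add: exp_sum_at_0 power2_eq_square mult.assoc)
        qed
        ultimately show ?thesis by (simp add: eq_diff_eq)
      qed
      also have "norm \<dots> \<le> v + norm (deriv (deriv r) 0)"
        using norm_triangle_ineq4[of "of_real v" "deriv (deriv r) 0"] v by simp
      also have "norm (deriv (deriv r) 0) \<le> 64 * D"
        using norm_deriv_le_of_bounded[OF hol_r r_le, where m = 2 and x = 0]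
        by (simp add: numeral_2_eq_2)
      finally show ?thesis using D by simp
    next
      case False
      then show ?thesis using v D by simp
    qed
    then have "S \<le> (v + 68 * D) / \<epsilon>"
      using \<epsilon> by (simp add: field_simps)
    also have "v + 68 * D \<le> (1 + 68 * D) * (1 + v)"
      using v D by (simp add: algebra_simps)
    finally have S_le: "S \<le> (1 + 68 * D) / \<epsilon> * (1 + v)"
      using \<epsilon> by (simp add: divide_right_mono)
    have a_le: "norm (exp_sum a J w) \<le> 3 ^ K * S" if "norm (exp w) \<le> 3" for w
    proof -
      have "norm (exp_sum a J w) \<le> (\<Sum>j\<in>J. norm (a j) * norm (exp w) ^ j)"
        unfolding exp_sum_def
        by (rule order_trans[OF norm_sum]) (simp add: norm_mult exp_of_nat_mult norm_power)
      also have "\<dots> \<le> (\<Sum>j\<in>J. norm (a j) * 3 ^ K)"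
      proof (intro sum_mono mult_left_mono)
        fix j assume "j \<in> J"
        have "norm (exp w) ^ j \<le> 3 ^ j"
          using that by (intro power_mono) auto
        also have "(3::real) ^ j \<le> 3 ^ K"
          using \<open>j \<in> J\<close> by (intro power_increasing) (auto simp: J_def)
        finally show "norm (exp w) ^ j \<le> 3 ^ K" .
      qed simp
      finally show ?thesis
        by (simp add: S_def sum_distrib_left mult.commute)
    qed
    have "norm (G w) \<le> C * (1 + v)" if "w \<in> ball 0 1" for w
    proof -
      have "norm (G w) \<le> norm (exp_sum a J w) + norm (exp_sum a J 0) + norm (r w)"
        using norm_triangle_ineq[of "exp_sum a J w - exp_sum a J 0" "r w"]
          norm_triangle_ineq4[of "exp_sum a J w" "exp_sum a J 0"] by (simp add: G_def)
      also have "\<dots> \<le> 3 ^ K * S + 3 ^ K * S + 2 * D"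
        using exp_le3[OF that] by (intro add_mono a_le r_le that) auto
      also have "\<dots> \<le> 2 * 3 ^ K * ((1 + 68 * D) / \<epsilon> * (1 + v)) + 2 * D * (1 + v)"
      proof (rule add_mono)
        show "3 ^ K * S + 3 ^ K * S \<le> 2 * 3 ^ K * ((1 + 68 * D) / \<epsilon> * (1 + v))"
        proof -
          have "2 * 3 ^ K * S \<le> 2 * 3 ^ K * ((1 + 68 * D) / \<epsilon> * (1 + v))"
            using S_le by (intro mult_left_mono) auto
          then show ?thesis by linarith
        qed
        show "2 * D \<le> 2 * D * (1 + v)"
          using D v by (simp add: algebra_simps)
      qed
      also have "\<dots> = C * (1 + v)"
        unfolding C_def by (simp only: distrib_right mult.assoc)
      finally show ?thesis .
    qed
    moreover have "G 0 = 0" by (simp add: G_def r_def)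
    ultimately show "\<exists>G. G holomorphic_on ball 0 1 \<and> G 0 = 0 \<and>
             (\<forall>w\<in>ball 0 1. exp (G w) = exp_sum (\<lambda>j. of_real (p j)) {..N} w) \<and>
             (\<forall>w\<in>ball 0 1. norm (G w)
                \<le> C * (1 + ((\<Sum>j\<le>N. p j * (real j)\<^sup>2) - (\<Sum>j\<le>N. p j * real j)\<^sup>2)))"
      unfolding v_def[symmetric] \<phi>_def[symmetric]
      by (intro exI[of _ G] conjI ballI hol_G exp_G) auto
  qed
qed

section \<open>The condition on the roots\<close>

lemma sum_mset_real_nonneg:
  fixes f :: "'b \<Rightarrow> real"
  assumes "\<And>x. x \<in># Z \<Longrightarrow> 0 \<le> f x"
  shows "0 \<le> (\<Sum>x\<in>#Z. f x)"
  using assms by (induction Z) auto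

lemma ennreal_sum_mset_le:
  assumes "\<And>x. x \<in># Z \<Longrightarrow> 0 \<le> f x" and "\<And>x. x \<in># Z \<Longrightarrow> ennreal (f x) \<le> g x"
  shows "ennreal (\<Sum>x\<in>#Z. f x) \<le> (\<Sum>x\<in>#Z. g x)"
  using assms
proof (induction Z)
  case (add x Z)
  have "0 \<le> (\<Sum>x\<in>#Z. f x)"
    using add.prems by (intro sum_mset_real_nonneg) auto
  then have "ennreal (\<Sum>x\<in>#add_mset x Z. f x) = ennreal (f x) + ennreal (\<Sum>x\<in>#Z. f x)"
    using add.prems(1)[of x] by simp
  also have "\<dots> \<le> g x + (\<Sum>x\<in>#Z. g x)"
    using add.prems by (intro add_mono add.IH) auto
  finally show ?case by simp
qed simp

text \<open>
  A single term below \<open>6\<^bsup>-k\<^esup>\<close> puts its root outside the disc of radius \<open>6\<close> (the value \<open>\<infinity>\<close> at \<open>0\<close>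
  excludes the root \<open>0\<close>), and for roots of modulus at least \<open>1\<close> raising the exponent to an
  integer \<open>K\<close> only decreases the sum.
\<close>

lemma norm_neg_powr_sum_lessD:
  fixes k :: real and K :: nat
  assumes less: "(\<Sum>\<zeta>\<in>#Z. norm_neg_powr k \<zeta>) < ennreal (6 powr - k)" and k: "0 < k" "k \<le> K"
  shows "\<And>\<zeta>. \<zeta> \<in># Z \<Longrightarrow> 6 \<le> norm \<zeta>" and "(\<Sum>\<zeta>\<in>#Z. 1 / norm \<zeta> ^ K) \<le> 1"
proof -
  show ge6: "6 \<le> norm \<zeta>" if "\<zeta> \<in># Z" for \<zeta>
  proof (rule ccontr)
    assume "\<not> 6 \<le> norm \<zeta>"
    obtain Z' where Z: "Z = add_mset \<zeta> Z'"
      using multi_member_split[OF \<open>\<zeta> \<in># Z\<close>] by blast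
    have "norm_neg_powr k \<zeta> \<le> (\<Sum>\<zeta>\<in>#Z. norm_neg_powr k \<zeta>)"
      by (simp add: Z)
    also note less
    finally have lt: "norm_neg_powr k \<zeta> < ennreal (6 powr - k)" .
    then have "\<zeta> \<noteq> 0" by (auto simp: norm_neg_powr_def)
    then have "6 powr - k \<le> norm \<zeta> powr - k"
      using \<open>\<not> 6 \<le> norm \<zeta>\<close> k by (intro powr_mono2') auto
    then show False
      using lt \<open>\<zeta> \<noteq> 0\<close> by (simp add: norm_neg_powr_def ennreal_less_iff)
  qed
  have "ennreal (1 / norm \<zeta> ^ K) \<le> norm_neg_powr k \<zeta>" if "\<zeta> \<in># Z" for \<zeta>
  proof -
    have "\<zeta> \<noteq> 0" "1 \<le> norm \<zeta>" using ge6[OF that] by auto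
    then have "1 / norm \<zeta> ^ K = norm \<zeta> powr - real K"
      by (simp add: powr_minus_divide powr_realpow)
    also have "\<dots> \<le> norm \<zeta> powr - k"
      using k \<open>1 \<le> norm \<zeta>\<close> by (intro powr_mono) auto
    finally show ?thesis
      using \<open>\<zeta> \<noteq> 0\<close> by (simp add: norm_neg_powr_def ennreal_leI)
  qed
  then have "ennreal (\<Sum>\<zeta>\<in>#Z. 1 / norm \<zeta> ^ K) \<le> (\<Sum>\<zeta>\<in>#Z. norm_neg_powr k \<zeta>)"
    by (intro ennreal_sum_mset_le) auto
  also note less
  finally have "(\<Sum>\<zeta>\<in>#Z. 1 / norm \<zeta> ^ K) < 6 powr - k"
    by (simp add: ennreal_less_iff sum_mset_real_nonneg)
  also have "6 powr - k \<le> 6 powr 0"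
    using k by (intro powr_mono) auto
  finally show "(\<Sum>\<zeta>\<in>#Z. 1 / norm \<zeta> ^ K) \<le> 1" by simp
qed

section \<open>The central limit theorem\<close>

lemma (in prob_space) expectation_finite_range:
  fixes f :: "nat \<Rightarrow> 'b :: {banach, second_countable_topology}"
  assumes X: "X \<in> measurable M (count_space {0..n})"
  shows "(\<integral>\<omega>. f (X \<omega>) \<partial>M) = (\<Sum>j\<le>n. measure M {\<omega> \<in> space M. X \<omega> = j} *\<^sub>R f j)"
proof -
  let ?A = "\<lambda>j. {\<omega> \<in> space M. X \<omega> = j}"
  have A: "?A j \<in> sets M" if "j \<le> n" for j
  proof -
    have "X -` {j} \<inter> space M \<in> sets M"
      using that by (intro measurable_sets[OF X]) auto
    moreover have "X -` {j} \<inter> space M = ?A j" by auto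
    ultimately show ?thesis by simp
  qed
  have "(\<integral>\<omega>. f (X \<omega>) \<partial>M) = (\<integral>\<omega>. (\<Sum>j\<le>n. indicator (?A j) \<omega> *\<^sub>R f j) \<partial>M)"
  proof (rule Bochner_Integration.integral_cong)
    fix \<omega> assume \<omega>: "\<omega> \<in> space M"
    have "X \<omega> \<le> n"
      using measurable_space[OF X \<omega>] by simp
    have "(\<Sum>j\<le>n. indicator (?A j) \<omega> *\<^sub>R f j) = (\<Sum>j\<le>n. if j = X \<omega> then f j else 0)"
      using \<omega> by (intro sum.cong) (auto simp: indicator_def)
    then show "f (X \<omega>) = (\<Sum>j\<le>n. indicator (?A j) \<omega> *\<^sub>R f j)"
      using \<open>X \<omega> \<le> n\<close> by simp
  qed simp
  also have "\<dots> = (\<Sum>j\<le>n. (\<integral>\<omega>. indicator (?A j) \<omega> *\<^sub>R f j \<partial>M))"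
    using A by (intro Bochner_Integration.integral_sum integrable_scaleR_left integrable_real_indicator)
      (auto simp: emeasure_eq_measure)
  also have "\<dots> = (\<Sum>j\<le>n. measure M (?A j) *\<^sub>R f j)"
  proof (intro sum.cong refl)
    fix j assume j: "j \<in> {..n}"
    then have "integrable M (indicator (?A j) :: _ \<Rightarrow> real)"
      using A by (intro integrable_real_indicator) (auto simp: emeasure_eq_measure)
    then show "(\<integral>\<omega>. indicator (?A j) \<omega> *\<^sub>R f j \<partial>M) = measure M (?A j) *\<^sub>R f j"
      using A[of j] j by simp
  qed
  finally show ?thesis .
qed

theorem theorem4:
  fixes k :: real
    and M :: "nat \<Rightarrow> 'a measure"
    and X :: "nat \<Rightarrow> 'a \<Rightarrow> nat"
  assumes "k > 0"
    and "\<And>n. prob_space (M n)"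
    and "\<And>n. X n \<in> measurable (M n) (count_space {0..n})"
    and "filterlim (\<lambda>n. std_dev (M n) (X n)) at_top sequentially"
    and "(\<lambda>n. \<Sum>\<zeta>\<in>#proots (prob_gen_poly (M n) n (X n)). norm_neg_powr k \<zeta>) \<longlonglongrightarrow> 0"
  shows "satisfies_clt M X"
proof -
  define p where "p n j = measure (M n) {\<omega> \<in> space (M n). X n \<omega> = j}" for n j
  define m where "m n = (\<Sum>j\<le>n. p n j * real j)" for n
  define v where "v n = (\<Sum>j\<le>n. p n j * (real j)\<^sup>2) - (m n)\<^sup>2" for n
  define \<sigma> where "\<sigma> n = std_dev (M n) (X n)" for n
  define \<phi> where "\<phi> n = exp_sum (\<lambda>j. complex_of_real (p n j)) {..n}" for n
  define K where "K = max 1 (nat \<lceil>k\<rceil>)"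
  have K: "1 \<le> K" "k \<le> real K"
    by (auto simp: K_def) linarith
  note expect = prob_space.expectation_finite_range[OF assms(2) assms(3), folded p_def]
  have p0: "0 \<le> p n j" for n j
    by (simp add: p_def)
  have p1: "(\<Sum>j\<le>n. p n j) = 1" for n
    using expect[of n "\<lambda>_. 1 :: real"] prob_space.prob_space[OF assms(2)] by simp
  have mean: "mean (M n) (X n) = m n" for n
    unfolding mean_def m_def using expect[of n real] by simp
  have \<sigma>: "\<sigma> n = sqrt (v n)" for n
  proof -
    have "\<sigma> n = sqrt (\<Sum>j\<le>n. p n j * (real j - m n)\<^sup>2)"
      unfolding \<sigma>_def std_dev_def mean[unfolded mean_def]
      using expect[of n "\<lambda>j. (real j - m n)\<^sup>2"] by simp
    also have "(\<Sum>j\<le>n. p n j * (real j - m n)\<^sup>2) = v n"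
      unfolding v_def by (rule sum_weighted_variance[OF p1 m_def[symmetric]])
    finally show ?thesis .
  qed
  have \<sigma>_top: "filterlim \<sigma> at_top sequentially"
    using assms(4) by (simp add: \<sigma>_def [abs_def])
  have \<sigma>_ge: "eventually (\<lambda>n. c \<le> \<sigma> n) sequentially" for c
    using \<sigma>_top by (simp add: filterlim_at_top)
  have P: "prob_gen_poly (M n) n (X n) = (\<Sum>j\<le>n. monom (complex_of_real (p n j)) j)" for n
    by (simp add: prob_gen_poly_def p_def)

  obtain C where C: "0 \<le> C"
    and bound: "\<And>p N. \<lbrakk>\<And>j. 0 \<le> p j; (\<Sum>j\<le>N. p j) = 1;
           \<And>\<zeta>. \<zeta> \<in># proots (\<Sum>j\<le>N. monom (complex_of_real (p j)) j) \<Longrightarrow> 6 \<le> norm \<zeta>;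
           (\<Sum>\<zeta>\<in>#proots (\<Sum>j\<le>N. monom (complex_of_real (p j)) j). 1 / norm \<zeta> ^ K) \<le> 1\<rbrakk>
         \<Longrightarrow> \<exists>G. G holomorphic_on ball 0 1 \<and> G 0 = 0 \<and>
             (\<forall>w\<in>ball 0 1. exp (G w) = exp_sum (\<lambda>j. of_real (p j)) {..N} w) \<and>
             (\<forall>w\<in>ball 0 1. norm (G w)
                \<le> C * (1 + ((\<Sum>j\<le>N. p j * (real j)\<^sup>2) - (\<Sum>j\<le>N. p j * real j)\<^sup>2)))"
    by (rule log_mgf_bounded_by_variance[OF K(1)]) (rule that, assumption, blast)
  (* good n G: G is the logarithm of the moment generating function of X n, with the uniform
     bound. Such a G exists only for large n, hence the choice operator. *)
  define good where "good n G \<longleftrightarrow> G holomorphic_on ball 0 1 \<and> G 0 = 0 \<and>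
      (\<forall>w\<in>ball 0 1. exp (G w) = \<phi> n w) \<and> (\<forall>w\<in>ball 0 1. norm (G w) \<le> C * (1 + v n))" for n G
  define G where "G n = (SOME G. good n G)" for n
  have "eventually (\<lambda>n. (\<Sum>\<zeta>\<in>#proots (prob_gen_poly (M n) n (X n)). norm_neg_powr k \<zeta>) < ennreal (6 powr - k)) sequentially"
    using assms(5) by (rule order_tendstoD) simp
  then have good: "eventually (\<lambda>n. good n (G n)) sequentially"
  proof eventually_elim
    case (elim n)
    have "\<exists>G. good n G"
      unfolding good_def \<phi>_def v_def m_def
      by (rule bound[OF p0 p1]) (use norm_neg_powr_sum_lessD[OF elim[unfolded P] assms(1) K(2)] in auto)
    then show ?case
      unfolding G_def by (rule someI_ex)
  qed

  define Y where "Y n = (\<lambda>\<omega>. (real (X n \<omega>) - mean (M n) (X n)) / std_dev (M n) (X n))" for n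
  have Y_meas [measurable]: "Y n \<in> borel_measurable (M n)" for n
    unfolding Y_def by (rule measurable_compose[OF assms(3)]) simp
  have char_Y: "char (distr (M n) borel (Y n)) t
      = exp (- (\<i> * of_real (t * m n / \<sigma> n))) * \<phi> n (\<i> * of_real (t / \<sigma> n))" for n t
  proof -
    have "char (distr (M n) borel (Y n)) t = (CLINT \<omega>|M n. iexp (t * Y n \<omega>))"
      unfolding char_def by (rule integral_distr) simp_all
    also have "\<dots> = (\<Sum>j\<le>n. p n j *\<^sub>R iexp (t * ((real j - m n) / \<sigma> n)))"
      unfolding Y_def mean \<sigma>_def[symmetric] by (rule expect)
    also have "\<dots> = (\<Sum>j\<le>n. exp (- (\<i> * of_real (t * m n / \<sigma> n))) *
        (of_real (p n j) * exp (of_nat j * (\<i> * of_real (t / \<sigma> n)))))"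
    proof (intro sum.cong refl)
      fix j
      have "\<i> * of_real (t * ((real j - m n) / \<sigma> n))
          = - (\<i> * of_real (t * m n / \<sigma> n)) + of_nat j * (\<i> * of_real (t / \<sigma> n))"
        by (simp add: diff_divide_distrib right_diff_distrib algebra_simps)
      then show "p n j *\<^sub>R iexp (t * ((real j - m n) / \<sigma> n))
          = exp (- (\<i> * of_real (t * m n / \<sigma> n))) * (of_real (p n j) * exp (of_nat j * (\<i> * of_real (t / \<sigma> n))))"
        by (simp only: exp_add scaleR_conv_of_real mult.left_commute)
    qed
    also have "\<dots> = exp (- (\<i> * of_real (t * m n / \<sigma> n))) * \<phi> n (\<i> * of_real (t / \<sigma> n))"
      by (simp add: \<phi>_def exp_sum_def sum_distrib_left)
    finally show ?thesis .
  qed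

  have "(\<lambda>n. char (distr (M n) borel (Y n)) t) \<longlonglongrightarrow> char std_normal_distribution t" for t
  proof -
    (* E n is the exponent of the characteristic function of Y n at t; the condition
       2 |t| <= sigma n keeps i t / sigma n inside the disc where the Taylor estimate holds. *)
    define E where "E n = G n (\<i> * of_real (t / \<sigma> n)) - \<i> * of_real (t * m n / \<sigma> n)" for n
    have "eventually (\<lambda>n. norm (E n - of_real (- (t\<^sup>2) / 2)) \<le> 384 * C * \<bar>t\<bar> ^ 3 / \<sigma> n) sequentially"
      using good \<sigma>_ge[of 1] \<sigma>_ge[of "2 * \<bar>t\<bar>"]
    proof eventually_elim
      case (elim n)
      let ?w = "\<i> * complex_of_real (t / \<sigma> n)"
      from elim have hol: "G n holomorphic_on ball 0 1" and G0: "G n 0 = 0"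
        and eG: "\<And>w. w \<in> ball 0 1 \<Longrightarrow> exp (G n w) = exp_sum (\<lambda>j. of_real (p n j)) {..n} w"
        and bd: "\<And>w. w \<in> ball 0 1 \<Longrightarrow> norm (G n w) \<le> C * (1 + v n)"
        by (auto simp: good_def \<phi>_def)
      have \<sigma>n: "1 \<le> \<sigma> n" "2 * \<bar>t\<bar> \<le> \<sigma> n" using elim by auto
      have "1 \<le> v n"
        using \<sigma>n(1) by (simp add: \<sigma>)
      then have \<sigma>2: "(\<sigma> n)\<^sup>2 = v n" by (simp add: \<sigma>)
      have c1: "(\<Sum>j\<le>n. complex_of_real (p n j)) = 1"
        using p1[of n] by (simp flip: of_real_sum)
      have d1: "deriv (G n) 0 = of_real (m n)"
        using log_exp_sum_derivs(1)[OF hol zero_less_one eG c1] by (simp add: m_def mult.commute)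
      have d2: "deriv (deriv (G n)) 0 = of_real (v n)"
        using log_exp_sum_derivs(2)[OF hol zero_less_one eG c1] by (simp add: v_def m_def mult.commute)
      have w: "norm ?w = \<bar>t\<bar> / \<sigma> n"
        using \<sigma>n by (simp add: norm_mult norm_divide)
      have w_half: "norm ?w \<le> 1 / 2"
        unfolding w using \<sigma>n by (simp add: field_simps)
      have "norm (G n ?w - (G n 0 + deriv (G n) 0 * ?w + deriv (deriv (G n)) 0 * ?w\<^sup>2 / 2))
          \<le> 192 * (C * (1 + v n)) * norm ?w ^ 3"
        by (rule norm_taylor2_remainder_le[OF hol bd w_half])
      moreover have "deriv (deriv (G n)) 0 * ?w\<^sup>2 = of_real (- (t\<^sup>2))"
      proof -
        have "v n * (t / \<sigma> n)\<^sup>2 = t\<^sup>2"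
          using \<sigma>n by (simp add: power_divide flip: \<sigma>2)
        then have "of_real (v n) * ?w\<^sup>2 = - complex_of_real (t\<^sup>2)"
          by (simp only: power_mult_distrib power2_i mult_minus1 mult_minus_right
              flip: of_real_mult of_real_power)
        then show ?thesis
          by (simp add: d2)
      qed
      moreover have "deriv (G n) 0 * ?w = \<i> * of_real (t * m n / \<sigma> n)"
        by (simp add: d1)
      ultimately have "norm (E n - of_real (- (t\<^sup>2) / 2)) \<le> 192 * (C * (1 + v n)) * norm ?w ^ 3"
        by (simp only: E_def G0 add_0_left of_real_divide of_real_numeral diff_diff_eq)
      then have "norm (E n - of_real (- (t\<^sup>2) / 2)) \<le> 192 * (C * (1 + v n)) * (\<bar>t\<bar> / \<sigma> n) ^ 3"
        by (simp only: w)
      also have "\<dots> \<le> 192 * (C * (2 * v n)) * (\<bar>t\<bar> / \<sigma> n) ^ 3"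
        using \<open>1 \<le> v n\<close> C \<sigma>n by (intro mult_right_mono mult_left_mono) auto
      also have "\<dots> = 384 * C * \<bar>t\<bar> ^ 3 / \<sigma> n"
        using \<sigma>n by (simp add: power_divide power2_eq_square power3_eq_cube flip: \<sigma>2)
      finally show ?case .
    qed
    moreover have "(\<lambda>n. 384 * C * \<bar>t\<bar> ^ 3 / \<sigma> n) \<longlonglongrightarrow> 0"
      by (rule real_tendsto_divide_at_top[OF tendsto_const \<sigma>_top])
    ultimately have "(\<lambda>n. E n - of_real (- (t\<^sup>2) / 2)) \<longlonglongrightarrow> 0"
      by (rule Lim_null_comparison)
    then have "E \<longlonglongrightarrow> of_real (- (t\<^sup>2) / 2)"
      by (simp only: LIM_zero_cancel)
    then have "(\<lambda>n. exp (E n)) \<longlonglongrightarrow> exp (of_real (- (t\<^sup>2) / 2))"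
      by (rule tendsto_exp)
    moreover have "exp (of_real (- (t\<^sup>2) / 2)) = char std_normal_distribution t"
      by (simp add: char_std_normal_distribution flip: exp_of_real)
    moreover have "eventually (\<lambda>n. exp (E n) = char (distr (M n) borel (Y n)) t) sequentially"
      using good \<sigma>_ge[of 1] \<sigma>_ge[of "2 * \<bar>t\<bar>"]
    proof eventually_elim
      case (elim n)
      let ?w = "\<i> * complex_of_real (t / \<sigma> n)"
      have "?w \<in> ball 0 1"
        using elim by (auto simp: norm_mult norm_divide divide_less_eq)
      then have "exp (G n ?w) = \<phi> n ?w"
        using elim unfolding good_def by blast
      then show ?case
        unfolding E_def char_Y by (simp only: exp_diff exp_minus divide_inverse mult.commute)
    qed
    ultimately show ?thesis
      using Lim_transform_eventually by metis
  qed
  then have "weak_conv_m (\<lambda>n. distr (M n) borel (Y n)) std_normal_distribution"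
    by (intro levy_continuity real_dist_normal_dist prob_space.real_distribution_distr assms(2) Y_meas)
  moreover have "eventually (\<lambda>n. 0 < std_dev (M n) (X n)) sequentially"
    using \<sigma>_ge[of 1] unfolding \<sigma>_def by eventually_elim simp
  ultimately show ?thesis
    unfolding satisfies_clt_def Y_def by blast
qed
end
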